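(* A connected monounary algebra is ultrahomogeneous if and only if it is isomorphic to either $\mathcal{B}_\alpha$ for some nonzero cardinal $\alpha$, or to $\mathcal{A}[n;\alpha_0,\alpha_1,\dots]$ for some $n\in\mathbb{N}$ and some (possibly finite, possibly empty) countable list of nonzero cardinals $\alpha_0,\alpha_1,\dots$.
   Context: A monounary algebra is a pair $\mathcal{A}=(A;\theta)$ where $A$ is a nonempty set (of arbitrary cardinality) and $\theta\colon A\to A$. It is connected if for all $x,y\in A$ there are $n,m\geq 0$ with $\theta^n(x)=\theta^m(y)$. Subalgebras are nonempty subsets closed under $\theta$; isomorphisms are bijections commuting with the operations. $\mathcal{A}$ is ultrahomogeneous if every isomorphism between finitely generated subalgebras of $\mathcal{A}$ extends to an automorphism of $\mathcal{A}$. $\mathbb{N}=\{1,2,\dots\}$. An element $x$ is cyclic if $\theta^n(x)=x$ for some $n\in\mathbb{N}$. The height $\mathrm{ht}(x)$ is the least $n\geq 0$ with $\theta^n(x)$ cyclic ($\infty$ if there is none). For a cardinal $\alpha>0$, $\mathcal{B}_\alpha$ denotes the (unique up to isomorphism) connected monounary algebra without cyclic elements in which $|\theta^{-1}(x)|=\alpha$ for every element $x$. For $n\in\mathbb{N}$ and a (possibly finite) countable list $\alpha_0,\alpha_1,\dots$ of nonzero cardinals, $\mathcal{A}[n;\alpha_0,\alpha_1,\dots]$ denotes the (unique up to isomorphism) connected monounary algebra whose set $C$ of cyclic elements has size $n$, with $|\theta^{-1}(c)\setminus C|=\alpha_0$ for each $c\in C$, and $|\theta^{-1}(x)|=\alpha_k$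 for every $x$ with $\mathrm{ht}(x)=k>0$. If the list is finite, missing entries are read as $0$ (so with list $\alpha_0,\dots,\alpha_h$ the elements of height $h+1$ have no preimages, and with the empty list the algebra is just an $n$-cycle). *)

theory Defs
  imports "HOL.Hull" "HOL-Library.Extended_Nat"
begin

unbundle cardinal_syntax

record 'a monounary =
  carr :: "'a set"
  opn :: "'a \<Rightarrow> 'a"

text \<open>
  The operation is a total function on the type; only its values on the carrier matter.
\<close>

definition monounary_algebra :: "'a monounary \<Rightarrow> bool" where
  "monounary_algebra M \<longleftrightarrow> carr M \<noteq> {} \<and> (\<forall>x\<in>carr M. opn M x \<in> carr M)"

definition connected_algebra :: "'a monounary \<Rightarrow> bool" where
  "connected_algebra M \<longleftrightarrow>
     (\<forall>x\<in>carr M. \<forall>y\<in>carr M. \<exists>n m. (opn M ^^ n) x = (opn M ^^ m) y)"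

definition subalgebra :: "'a monounary \<Rightarrow> 'a set \<Rightarrow> bool" where
  "subalgebra M S \<longleftrightarrow> S \<noteq> {} \<and> S \<subseteq> carr M \<and> (\<forall>x\<in>S. opn M x \<in> S)"

definition finitely_generated :: "'a monounary \<Rightarrow> 'a set \<Rightarrow> bool" where
  "finitely_generated M S \<longleftrightarrow>
     (\<exists>F. finite F \<and> F \<noteq> {} \<and> F \<subseteq> carr M \<and> S = subalgebra M hull F)"

abbreviation restrict_alg :: "'a monounary \<Rightarrow> 'a set \<Rightarrow> 'a monounary" where
  "restrict_alg M S \<equiv> M\<lparr>carr := S\<rparr>"

definition isomorphism :: "('a \<Rightarrow> 'b) \<Rightarrow> 'a monounary \<Rightarrow> 'b monounary \<Rightarrow> bool" where
  "isomorphism f M N \<longleftrightarrow>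
     bij_betw f (carr M) (carr N) \<and> (\<forall>x\<in>carr M. f (opn M x) = opn N (f x))"

definition isomorphic :: "'a monounary \<Rightarrow> 'b monounary \<Rightarrow> bool" where
  "isomorphic M N \<longleftrightarrow> (\<exists>f. isomorphism f M N)"

definition ultrahomogeneous :: "'a monounary \<Rightarrow> bool" where
  "ultrahomogeneous M \<longleftrightarrow>
     (\<forall>S T f.
        subalgebra M S \<and> finitely_generated M S \<and>
        subalgebra M T \<and> finitely_generated M T \<and>
        isomorphism f (restrict_alg M S) (restrict_alg M T)
        \<longrightarrow> (\<exists>g. isomorphism g M M \<and> (\<forall>x\<in>S. g x = f x)))"

definition cyclic :: "'a monounary \<Rightarrow> 'a \<Rightarrow> bool" where
  "cyclic M x \<longleftrightarrow> (\<exists>n\<ge>1. (opn M ^^ n) x = x)"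

definition cyclic_set :: "'a monounary \<Rightarrow> 'a set" where
  "cyclic_set M = {x \<in> carr M. cyclic M x}"

definition ht :: "'a monounary \<Rightarrow> 'a \<Rightarrow> enat" where
  "ht M x =
     (if \<exists>n. cyclic M ((opn M ^^ n) x)
      then enat (LEAST n. cyclic M ((opn M ^^ n) x)) else \<infinity>)"

definition preim :: "'a monounary \<Rightarrow> 'a \<Rightarrow> 'a set" where
  "preim M x = {y \<in> carr M. opn M y = x}"

text \<open>
  The algebras \<open>\<B>\<^sub>\<alpha>\<close> and \<open>\<A>[n; \<alpha>\<^sub>0, \<alpha>\<^sub>1, \<dots>]\<close> are only determined up to isomorphism by
  their descriptions, the predicates \<open>is_B_alg\<close> and \<open>is_A_alg\<close>.  The constants \<open>B_alg\<close> and
  \<open>A_alg\<close> choose one algebra meeting the description; \<open>is_B_alg_B_alg\<close> and \<open>is_A_alg_A_alg\<close>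
  show that there is one.  The carrier type \<open>nat \<times> 'c list\<close> is large enough for this if the
  cardinals are given as cardinal orders on \<open>'c\<close>.

  A finite or infinite list of nonzero cardinals is a sequence \<open>\<alpha>\<close> indexed by the naturals,
  in which the entries beyond the length \<open>h\<close> of the list are zero.
\<close>

definition is_B_alg :: "'c rel \<Rightarrow> 'a monounary \<Rightarrow> bool" where
  "is_B_alg \<alpha> M \<longleftrightarrow>
     monounary_algebra M \<and> connected_algebra M \<and> cyclic_set M = {} \<and>
     (\<forall>x\<in>carr M. |preim M x| =o \<alpha>)"

definition B_alg :: "'c rel \<Rightarrow> (nat \<times> 'c list) monounary" where
  "B_alg \<alpha> = (SOME M. is_B_alg \<alpha> M)"

definition cardinal_list :: "(nat \<Rightarrow> 'c rel) \<Rightarrow> bool" where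
  "cardinal_list \<alpha> \<longleftrightarrow>
     (\<exists>h::enat. \<forall>k. if enat k < h then Cnotzero (\<alpha> k) else \<alpha> k = czero)"

definition is_A_alg :: "nat \<Rightarrow> (nat \<Rightarrow> 'c rel) \<Rightarrow> 'a monounary \<Rightarrow> bool" where
  "is_A_alg n \<alpha> M \<longleftrightarrow>
     monounary_algebra M \<and> connected_algebra M \<and>
     finite (cyclic_set M) \<and> card (cyclic_set M) = n \<and>
     (\<forall>c\<in>cyclic_set M. |preim M c - cyclic_set M| =o \<alpha> 0) \<and>
     (\<forall>x\<in>carr M. \<forall>k>0. ht M x = enat k \<longrightarrow> |preim M x| =o \<alpha> k)"

definition A_alg :: "nat \<Rightarrow> (nat \<Rightarrow> 'c rel) \<Rightarrow> (nat \<times> 'c list) monounary" where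
  "A_alg n \<alpha> = (SOME M. is_A_alg n \<alpha> M)"


subsection \<open>Existence\<close>

text \<open>
  In both models below, \<open>(k, xs)\<close> is the element reached from the \<open>k\<close>-th element of a
  chain (respectively, a cycle) by going down a tree along \<open>xs\<close>.  In the model of \<open>\<B>\<^sub>\<alpha>\<close>,
  the first step down must not be along \<open>c\<close> (except at \<open>k = 0\<close>), because that branch is
  the chain itself.
\<close>

lemma card_of_preim:
  assumes "Card_order r" "inj_on f (Field r)" "f ` Field r = X"
  shows "|X| =o r"
proof -
  have "bij_betw f (Field r) X"
    using assms by (simp add: bij_betw_def)
  then have "|Field r| =o |X|"
    by (rule card_of_ordIsoI)
  then show ?thesis
    using assms(1) card_of_Field_ordIso ordIso_symmetric ordIso_transitive by blast
qed

lemma B_alg_exists: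
  fixes \<alpha> :: "'c rel"
  assumes "Cnotzero \<alpha>"
  shows "\<exists>M :: (nat \<times> 'c list) monounary. is_B_alg \<alpha> M"
proof -
  have co: "Card_order \<alpha>" and nz: "\<not> \<alpha> =o (czero :: 'c rel)"
    using assms by auto
  have "Field \<alpha> \<noteq> {}"
  proof
    assume "Field \<alpha> = {}"
    then have "\<alpha> =o (czero :: 'c rel)"
      using card_of_Field_ordIso[OF co] ordIso_symmetric by (fastforce simp: czero_def)
    with nz show False by simp
  qed
  then obtain c where c: "c \<in> Field \<alpha>" by blast
  define op :: "nat \<times> 'c list \<Rightarrow> nat \<times> 'c list" where
    "op = (\<lambda>(k, xs). if xs = [] then (Suc k, []) else (k, butlast xs))"
  define A :: "(nat \<times> 'c list) set" where
    "A = {(k, xs). set xs \<subseteq> Field \<alpha> \<and> (k = 0 \<or> xs = [] \<or> hd xs \<noteq> c)}"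
  define M where "M = \<lparr>carr = A, opn = op\<rparr>"
  have [simp]: "carr M = A" "opn M = op" by (simp_all add: M_def)
  have op_Nil: "op (k, []) = (Suc k, [])" and op_snoc: "op (k, xs @ [a]) = (k, xs)" for k xs a
    by (simp_all add: op_def)
  have op_single: "op (k, [a]) = (k, [])" for k a
    by (simp add: op_def)
  have mon: "monounary_algebra M"
  proof -
    have "(0, []) \<in> A" by (simp add: A_def)
    moreover have "op x \<in> A" if "x \<in> A" for x
    proof (cases x)
      case (Pair k xs)
      show ?thesis
        using that unfolding Pair by (cases xs rule: rev_cases)
          (auto simp: A_def op_Nil op_snoc hd_append split: if_splits)
    qed
    ultimately show ?thesis by (auto simp: monounary_algebra_def)
  qed
  have down: "(op ^^ length xs) (k, xs) = (k, [])" for k xs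
    by (induction xs rule: rev_induct) (simp_all add: op_snoc funpow_Suc_right del: funpow.simps)
  have up: "(op ^^ m) (k, []) = (k + m, [])" for k m
    by (induction m) (simp_all add: op_Nil)
  have to: "(op ^^ (m + length xs)) (k, xs) = (k + m, [])" for k m xs
    by (simp add: funpow_add down up)
  have "connected_algebra M"
    unfolding connected_algebra_def
  proof (intro ballI)
    fix x y assume "x \<in> carr M" "y \<in> carr M"
    obtain k xs l ys where [simp]: "x = (k, xs)" "y = (l, ys)" by fastforce
    have "(opn M ^^ (l + length xs)) x = (opn M ^^ (k + length ys)) y"
      by (simp add: to add.commute)
    then show "\<exists>n m. (opn M ^^ n) x = (opn M ^^ m) y" by blast
  qed
  moreover have "cyclic_set M = {}"
  proof -
    define d where "d = (\<lambda>(k::nat, xs::'c list). int k - int (length xs))"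
    have d1: "d (op x) = d x + 1" for x
    proof (cases x)
      case (Pair k xs)
      then show ?thesis
        by (cases xs rule: rev_cases) (simp_all add: d_def op_Nil op_snoc)
    qed
    have "d ((op ^^ m) x) = d x + int m" for m x
      by (induction m) (simp_all add: d1)
    then have "\<not> cyclic M x" for x
      unfolding cyclic_def by (metis \<open>opn M = op\<close> add_cancel_left_right int_eq_iff
        not_one_le_zero of_nat_0)
    then show ?thesis by (simp add: cyclic_set_def)
  qed
  moreover have "|preim M x| =o \<alpha>" if "x \<in> A" for x
  proof (cases x)
    case (Pair k xs)
    define f where
      "f = (\<lambda>a. if xs = [] \<and> k > 0 \<and> a = c then (k - 1, []) else (k, xs @ [a]))"
    have "inj_on f (Field \<alpha>)"
      by (auto simp: inj_on_def f_def split: if_splits)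
    moreover have "f ` Field \<alpha> = preim M x"
    proof (intro equalityI subsetI)
      fix y assume "y \<in> f ` Field \<alpha>"
      then show "y \<in> preim M x"
        using that c unfolding Pair
        by (auto simp: f_def preim_def A_def op_Nil op_snoc op_single hd_append split: if_splits)
    next
      fix y assume y: "y \<in> preim M x"
      obtain l ys where [simp]: "y = (l, ys)" by fastforce
      show "y \<in> f ` Field \<alpha>"
      proof (cases ys rule: rev_cases)
        case Nil
        then have "y = f c" using y unfolding Pair by (auto simp: f_def preim_def op_Nil)
        then show ?thesis using c by blast
      next
        case (snoc zs a)
        then have "y = f a" "a \<in> Field \<alpha>"
          using y unfolding Pair by (auto simp: f_def preim_def A_def op_snoc)
        then show ?thesis by blast
      qed
    qed
    ultimately show ?thesis using co card_of_preim by blast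
  qed
  ultimately have "is_B_alg \<alpha> M"
    using mon by (simp add: is_B_alg_def)
  then show ?thesis by blast
qed

lemma is_B_alg_B_alg: "Cnotzero \<alpha> \<Longrightarrow> is_B_alg \<alpha> (B_alg \<alpha>)"
  unfolding B_alg_def by (rule someI_ex) (rule B_alg_exists)

lemma A_alg_exists:
  fixes \<alpha> :: "nat \<Rightarrow> 'c rel"
  assumes n: "n \<ge> 1" and \<alpha>: "cardinal_list \<alpha>"
  shows "\<exists>M :: (nat \<times> 'c list) monounary. is_A_alg n \<alpha> M"
proof -
  have co: "Card_order (\<alpha> k)" for k
    using \<alpha> unfolding cardinal_list_def by (metis card_of_Card_order czero_def)
  define op :: "nat \<times> 'c list \<Rightarrow> nat \<times> 'c list" where
    "op = (\<lambda>(k, xs). if xs = [] then (Suc k mod n, []) else (k, butlast xs))"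
  define A :: "(nat \<times> 'c list) set" where
    "A = {(k, xs). k < n \<and> (\<forall>i<length xs. xs ! i \<in> Field (\<alpha> i))}"
  define M where "M = \<lparr>carr = A, opn = op\<rparr>"
  have [simp]: "carr M = A" "opn M = op" by (simp_all add: M_def)
  have op_Nil: "op (k, []) = (Suc k mod n, [])" and op_snoc: "op (k, xs @ [a]) = (k, xs)"
    for k xs a
    by (simp_all add: op_def)
  have snoc_in: "(k, xs @ [a]) \<in> A \<longleftrightarrow> (k, xs) \<in> A \<and> a \<in> Field (\<alpha> (length xs))" for k xs a
    by (auto simp: A_def nth_append less_Suc_eq split: if_splits)
  have mon: "monounary_algebra M"
  proof -
    have "(0, []) \<in> A" using n by (simp add: A_def)
    moreover have "op x \<in> A" if "x \<in> A" for x
    proof (cases x)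
      case (Pair k xs)
      show ?thesis
      proof (cases xs rule: rev_cases)
        case Nil
        then show ?thesis using n unfolding Pair by (simp add: op_Nil A_def)
      next
        case (snoc ys a)
        then show ?thesis using that unfolding Pair by (simp add: op_snoc snoc_in)
      qed
    qed
    ultimately show ?thesis by (auto simp: monounary_algebra_def)
  qed
  have down: "(op ^^ length xs) (k, xs) = (k, [])" for k xs
    by (induction xs rule: rev_induct) (simp_all add: op_snoc funpow_Suc_right del: funpow.simps)
  have up: "(op ^^ m) (k, []) = ((k + m) mod n, [])" if "k < n" for k m
    using that by (induction m) (simp_all add: op_Nil mod_Suc_eq)
  have cyc: "cyclic M (k, xs) \<longleftrightarrow> xs = []" if "(k, xs) \<in> A" for k xs
  proof
    have kn: "k < n" using that by (simp add: A_def)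
    show "cyclic M (k, xs)" if "xs = []"
      using up[OF kn, of n] n kn that by (auto simp: cyclic_def intro!: exI[of _ n])
    assume "cyclic M (k, xs)"
    then obtain m where m: "m \<ge> 1" "(op ^^ m) (k, xs) = (k, xs)"
      by (auto simp: cyclic_def)
    have len: "length (snd ((op ^^ j) x)) = length (snd x) - j" for j x
    proof (induction j)
      case (Suc j)
      obtain l ys where y: "(op ^^ j) x = (l, ys)" by fastforce
      show ?case
        using Suc y by (cases ys rule: rev_cases) (simp_all add: op_Nil op_snoc)
    qed simp
    show "xs = []"
      using len[of m "(k, xs)"] m by (cases xs) auto
  qed
  have C: "cyclic_set M = (\<lambda>k. (k, [])) ` {..<n}"
  proof -
    have "x \<in> cyclic_set M \<longleftrightarrow> x \<in> (\<lambda>k. (k, [])) ` {..<n}" for x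
      using cyc by (cases x) (auto simp: cyclic_set_def A_def)
    then show ?thesis by blast
  qed
  have "connected_algebra M"
    unfolding connected_algebra_def
  proof (intro ballI)
    fix x y assume xy: "x \<in> carr M" "y \<in> carr M"
    obtain k xs l ys where [simp]: "x = (k, xs)" "y = (l, ys)" by fastforce
    have "k < n" "l < n" using xy by (auto simp: A_def)
    then have "(op ^^ (l + length xs)) x = (op ^^ (k + length ys)) y"
      by (simp add: funpow_add down up add.commute)
    then show "\<exists>n m. (opn M ^^ n) x = (opn M ^^ m) y" by auto
  qed
  moreover have "finite (cyclic_set M)" "card (cyclic_set M) = n"
    unfolding C by (simp_all add: card_image inj_on_def)
  moreover have "|preim M x - cyclic_set M| =o \<alpha> 0" if x: "x \<in> cyclic_set M" for x
  proof -
    obtain k where k: "x = (k, [])" "k < n" using x unfolding C by auto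
    have "y \<in> (\<lambda>a. (k, [a])) ` Field (\<alpha> 0) \<longleftrightarrow> y \<in> preim M x - cyclic_set M" for y
    proof (cases y)
      case (Pair l ys)
      show ?thesis
        unfolding Pair C preim_def k(1) using k(2)
        by (cases ys rule: rev_cases) (auto simp: op_Nil op_snoc A_def)
    qed
    then have "(\<lambda>a. (k, [a])) ` Field (\<alpha> 0) = preim M x - cyclic_set M" by blast
    then show ?thesis
      by (intro card_of_preim[OF co, of "\<lambda>a. (k, [a])"]) (simp_all add: inj_on_def)
  qed
  moreover have "|preim M x| =o \<alpha> h" if x: "x \<in> A" and h: "h > 0" "ht M x = enat h" for x h
  proof -
    obtain k xs where [simp]: "x = (k, xs)" by fastforce
    have "xs \<noteq> []"
    proof
      assume "xs = []"
      then have "cyclic M x" using cyc x by simp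
      then have "ht M x = enat 0"
        unfolding ht_def by (metis (mono_tags, lifting) Least_eq_0 funpow_0)
      with h show False by simp
    qed
    have cyc_take: "(op ^^ j) (k, xs) = (k, take (length xs - j) xs)" if "j \<le> length xs" for j
      using that
    proof (induction j)
      case (Suc j)
      then show ?case
        by (auto simp: op_def butlast_take)
    qed simp
    have iter_in: "(op ^^ j) x \<in> A" for j
      using mon x by (induction j) (auto simp: monounary_algebra_def)
    have "(LEAST j. cyclic M ((op ^^ j) x)) = length xs"
    proof (rule Least_equality)
      show "cyclic M ((op ^^ length xs) x)"
        using cyc iter_in[of "length xs"] by (simp add: down)
      fix j assume j: "cyclic M ((op ^^ j) x)"
      show "length xs \<le> j"
      proof (rule ccontr)
        assume "\<not> length xs \<le> j"
        then show False
          using j cyc iter_in[of j] cyc_take[of j] by auto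
      qed
    qed
    moreover have "ht M x = enat (LEAST j. cyclic M ((op ^^ j) x))"
      using h by (auto simp: ht_def split: if_splits)
    ultimately have hl: "h = length xs" using h by simp
    have "y \<in> (\<lambda>a. (k, xs @ [a])) ` Field (\<alpha> h) \<longleftrightarrow> y \<in> preim M x" for y
    proof (cases y)
      case (Pair l ys)
      show ?thesis
        unfolding Pair preim_def hl using x \<open>xs \<noteq> []\<close>
        by (cases ys rule: rev_cases) (auto simp: op_Nil op_snoc snoc_in)
    qed
    then have "(\<lambda>a. (k, xs @ [a])) ` Field (\<alpha> h) = preim M x" by blast
    then show ?thesis
      by (intro card_of_preim[OF co, of "\<lambda>a. (k, xs @ [a])"]) (simp_all add: inj_on_def)
  qed
  ultimately have "is_A_alg n \<alpha> M"
    using mon by (simp add: is_A_alg_def)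
  then show ?thesis by blast
qed

lemma is_A_alg_A_alg: "n \<ge> 1 \<Longrightarrow> cardinal_list \<alpha> \<Longrightarrow> is_A_alg n \<alpha> (A_alg n \<alpha>)"
  unfolding A_alg_def by (rule someI_ex) (rule A_alg_exists)

end

theory Submission
  imports Defs
begin

text \<open>
  Two elements of a connected algebra \<open>M\<close> generate isomorphic subalgebras, by an isomorphism
  matching the generators, iff they have the same height. So if \<open>M\<close> is ultrahomogeneous, the
  number of non-cyclic preimages of \<open>x\<close> depends only on the height of \<open>x\<close> (\<open>level_regular\<close>).
  Conversely, let this number depend only on the height. An isomorphism between finitely
  generated subalgebras \<open>S\<close> and \<open>T\<close> preserves heights, and \<open>S\<close> and \<open>T\<close> contain all cyclic
  elements and only finitely many preimages of each point; hence \<open>x\<close> and its image have equally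
  many preimages outside \<open>S\<close> and \<open>T\<close>, and the isomorphism can be extended level by level.
  The same extension between two different algebras, started at a single orbit, shows that the
  descriptions of \<open>\<B>\<^sub>\<alpha>\<close> and \<open>\<A>[n; \<alpha>\<^sub>0, \<dots>]\<close> determine them up to isomorphism.
\<close>

subsection \<open>Orbits and cyclic elements\<close>

definition orb :: "'a monounary \<Rightarrow> 'a \<Rightarrow> 'a set" where
  "orb M x = range (\<lambda>n. (opn M ^^ n) x)"

lemma funpow_closed:
  assumes "\<And>x. x \<in> S \<Longrightarrow> f x \<in> S" "x \<in> S"
  shows "(f ^^ n) x \<in> S"
  using assms by (induction n) auto

lemma monounary_algebra_funpow:
  "monounary_algebra M \<Longrightarrow> x \<in> carr M \<Longrightarrow> (opn M ^^ n) x \<in> carr M"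
  by (rule funpow_closed) (auto simp: monounary_algebra_def)

lemma subalgebra_funpow: "subalgebra M S \<Longrightarrow> x \<in> S \<Longrightarrow> (opn M ^^ n) x \<in> S"
  by (rule funpow_closed) (auto simp: subalgebra_def)

lemma funpow_hom:
  assumes "\<And>x. x \<in> S \<Longrightarrow> p x \<in> S" "\<And>x. x \<in> S \<Longrightarrow> f (p x) = q (f x)" "x \<in> S"
  shows "f ((p ^^ n) x) = (q ^^ n) (f x)"
  by (induction n) (simp_all add: assms funpow_closed[of S])

lemma orb_self: "x \<in> orb M x"
  unfolding orb_def by (rule range_eqI[of _ _ 0]) simp

lemma orb_closed: "y \<in> orb M x \<Longrightarrow> opn M y \<in> orb M x"
proof -
  assume "y \<in> orb M x"
  then obtain n where "y = (opn M ^^ n) x" unfolding orb_def by blast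
  then show ?thesis
    unfolding orb_def by (intro range_eqI[of _ _ "Suc n"]) simp
qed

text \<open>As the only operation is unary, a nonempty union of orbits is closed, so different
  generators never interact.\<close>

lemma subalgebra_hull_eq:
  assumes "monounary_algebra M" "F \<subseteq> carr M" "F \<noteq> {}"
  shows "subalgebra M hull F = (\<Union>x\<in>F. orb M x)"
proof (rule hull_unique)
  show "F \<subseteq> (\<Union>x\<in>F. orb M x)"
    using orb_self by fast
  have "orb M x \<subseteq> carr M" if "x \<in> F" for x
    using monounary_algebra_funpow[OF assms(1)] assms(2) that by (auto simp: orb_def)
  then show "subalgebra M (\<Union>x\<in>F. orb M x)"
    unfolding subalgebra_def using assms(3) orb_self orb_closed by fast
next
  fix S assume "F \<subseteq> S" "subalgebra M S"
  then show "(\<Union>x\<in>F. orb M x) \<subseteq> S"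
    by (auto simp: orb_def subalgebra_funpow subsetD)
qed

lemma orb_finitely_generated:
  assumes "monounary_algebra M" "x \<in> carr M"
  shows "subalgebra M (orb M x)" "finitely_generated M (orb M x)"
proof -
  have h: "subalgebra M hull {x} = orb M x"
    using subalgebra_hull_eq[OF assms(1), of "{x}"] assms(2) by simp
  show "finitely_generated M (orb M x)"
    unfolding finitely_generated_def using assms(2) h
    by (intro exI[of _ "{x}"]) simp
  show "subalgebra M (orb M x)"
    unfolding subalgebra_def
  proof (intro conjI ballI)
    show "orb M x \<noteq> {}" using orb_self by fast
    show "orb M x \<subseteq> carr M"
      using monounary_algebra_funpow[OF assms] by (auto simp: orb_def)
    show "opn M y \<in> orb M x" if "y \<in> orb M x" for y
      using orb_closed[OF that] .
  qed
qed

section \<open>Cyclic elements, heights and the unique cycle\<close>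

lemma funpow_coincidence_cyclic:
  assumes "(opn M ^^ i) x = (opn M ^^ j) x" "i < j"
  shows "cyclic M ((opn M ^^ i) x)"
  unfolding cyclic_def
proof (intro exI conjI)
  show "1 \<le> j - i" using assms by simp
  have "(opn M ^^ (j - i)) ((opn M ^^ i) x) = (opn M ^^ (j - i + i)) x"
    by (simp only: funpow_add comp_apply)
  then show "(opn M ^^ (j - i)) ((opn M ^^ i) x) = (opn M ^^ i) x"
    using assms by simp
qed

lemma cyclic_funpow:
  assumes "cyclic M x"
  shows "cyclic M ((opn M ^^ n) x)"
  using assms unfolding cyclic_def
  by (metis (no_types) add.commute comp_apply funpow_add)

lemma cyclic_opn: "cyclic M x \<Longrightarrow> cyclic M (opn M x)"
  using cyclic_funpow[of M x 1] by simp

lemma cyclic_iff_ht: "cyclic M x \<longleftrightarrow> ht M x = 0"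
proof
  assume "cyclic M x"
  then have "cyclic M ((opn M ^^ 0) x)" by simp
  then show "ht M x = 0"
    unfolding ht_def by (metis (mono_tags, lifting) Least_eq_0 zero_enat_def)
next
  assume "ht M x = 0"
  then have ex: "\<exists>n. cyclic M ((opn M ^^ n) x)"
    and "(LEAST n. cyclic M ((opn M ^^ n) x)) = 0"
    by (auto simp: ht_def zero_enat_def split: if_splits)
  with LeastI_ex[OF ex] show "cyclic M x" by simp
qed

text \<open>The first cyclic iterate of \<open>x\<close> is not \<open>x\<close> itself, so it is
  met one step earlier from \<open>opn M x\<close>. \<open>eSuc\<close> fixes \<infinity>, which
  covers elements that never reach a cycle.\<close>

lemma ht_noncyclic:
  assumes "\<not> cyclic M x"
  shows "ht M x = eSuc (ht M (opn M x))"
proof -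
  let ?P = "\<lambda>n. cyclic M ((opn M ^^ n) x)"
  have shift: "?P (Suc n) = cyclic M ((opn M ^^ n) (opn M x))" for n
    by (simp add: funpow_swap1)
  show ?thesis
  proof (cases "\<exists>n. ?P n")
    case True
    then obtain n where n: "?P n" by blast
    have "(LEAST n. ?P n) = Suc (LEAST n. ?P (Suc n))"
      by (rule Least_Suc[where P = ?P and n = n]) (use n assms in auto)
    moreover have "\<exists>n. ?P (Suc n)"
      using n assms by (cases n) auto
    ultimately show ?thesis
      using True unfolding ht_def shift by (auto simp: eSuc_enat)
  next
    case False
    then have "\<nexists>n. cyclic M ((opn M ^^ n) (opn M x))"
      using shift by blast
    with False show ?thesis unfolding ht_def by simp
  qed
qed

lemma ht_enat_cyclic: "ht M x = enat k \<Longrightarrow> cyclic M ((opn M ^^ k) x)"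
  unfolding ht_def by (auto split: if_splits intro: LeastI)

lemma ht_le: "cyclic M ((opn M ^^ k) x) \<Longrightarrow> ht M x \<le> enat k"
  unfolding ht_def by (auto intro: Least_le)

text \<open>By connectedness \<open>x\<close> meets the forward orbit of \<open>c\<close>, and from
  there the walk goes round the cycle until it is back at \<open>c\<close>.\<close>

lemma cyclic_reachable:
  assumes "connected_algebra M" "x \<in> carr M" "c \<in> carr M" "cyclic M c"
  shows "\<exists>n. (opn M ^^ n) x = c"
proof -
  obtain n m where nm: "(opn M ^^ n) x = (opn M ^^ m) c"
    using assms unfolding connected_algebra_def by blast
  obtain p where p: "p \<ge> 1" "(opn M ^^ p) c = c"
    using assms(4) unfolding cyclic_def by blast
  \<comment> \<open>\<open>p * m\<close> is a multiple of the period that is at least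
    \<open>m\<close>, so \<open>p * m - m\<close> more steps lead from the meeting point back to
    \<open>c\<close>.\<close>
  have "(opn M ^^ (p * m)) c = c"
    using funpow_mod_eq[OF p(2), of "p * m"] by simp
  moreover have "p * m = (p * m - m) + m" using p(1) by simp
  ultimately have "(opn M ^^ (p * m - m)) ((opn M ^^ m) c) = c"
    by (metis comp_apply funpow_add)
  then have "(opn M ^^ (p * m - m + n)) x = c"
    by (simp add: funpow_add nm)
  then show ?thesis by blast
qed

lemma cyclic_set_subset_subalgebra:
  assumes "connected_algebra M" "subalgebra M S"
  shows "cyclic_set M \<subseteq> S"
proof
  fix c assume c: "c \<in> cyclic_set M"
  obtain x where x: "x \<in> S" "x \<in> carr M"
    using assms(2) unfolding subalgebra_def by blast
  with c obtain n where "(opn M ^^ n) x = c"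
    using cyclic_reachable[OF assms(1)] unfolding cyclic_set_def by blast
  then show "c \<in> S" using subalgebra_funpow[OF assms(2) x(1)] by blast
qed

lemma connected_reaches_subalgebra:
  assumes "connected_algebra M" "subalgebra M S" "x \<in> carr M"
  shows "\<exists>n. (opn M ^^ n) x \<in> S"
proof -
  obtain y where y: "y \<in> S" "y \<in> carr M"
    using assms(2) unfolding subalgebra_def by blast
  then obtain n m where "(opn M ^^ n) x = (opn M ^^ m) y"
    using assms unfolding connected_algebra_def by blast
  then show ?thesis using subalgebra_funpow[OF assms(2) y(1)] by metis
qed

text \<open>By reachability all cyclic elements lie in the orbit of \<open>c\<close>, so they form
  one cycle whose length is the least period of \<open>c\<close>.\<close>

lemma cyclic_orbit:
  assumes "monounary_algebra M" "connected_algebra M" "c \<in> cyclic_set M"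
  shows "finite (cyclic_set M)" "card (cyclic_set M) \<ge> 1"
    "(opn M ^^ i) c = (opn M ^^ j) c \<longleftrightarrow> i mod card (cyclic_set M) = j mod card (cyclic_set M)"
proof -
  have c: "c \<in> carr M" "cyclic M c" using assms(3) by (auto simp: cyclic_set_def)
  let ?P = "\<lambda>p. p \<ge> 1 \<and> (opn M ^^ p) c = c"
  define p where "p = (LEAST p. ?P p)"
  have p: "p \<ge> 1" "(opn M ^^ p) c = c"
    using LeastI_ex[of ?P] c(2) unfolding p_def cyclic_def by auto
  have least: "p \<le> q" if "?P q" for q
    unfolding p_def using that by (rule Least_le)
  have "(opn M ^^ i) c \<noteq> (opn M ^^ j) c" if "i < j" "j < p" for i j
  proof
    assume eq: "(opn M ^^ i) c = (opn M ^^ j) c"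
    \<comment> \<open>Another \<open>p - j\<close> steps turn the coincidence into the period
      \<open>p - j + i\<close>, which is smaller than \<open>p\<close>.\<close>
    have "(opn M ^^ (p - j + i)) c = (opn M ^^ (p - j + j)) c"
      using eq by (simp only: funpow_add comp_apply)
    also have "\<dots> = c" using p(2) that by simp
    finally have "?P (p - j + i)" using that by simp
    then show False using least[of "p - j + i"] that by linarith
  qed
  then have inj: "inj_on (\<lambda>i. (opn M ^^ i) c) {..<p}"
    unfolding inj_on_def by (metis lessThan_iff nat_neq_iff)
  have C: "cyclic_set M = (\<lambda>i. (opn M ^^ i) c) ` {..<p}"
  proof (intro equalityI subsetI)
    fix y assume "y \<in> cyclic_set M"
    then obtain n where "(opn M ^^ n) c = y"
      using cyclic_reachable[OF assms(2) c(1)] unfolding cyclic_set_def by blast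
    then have "(opn M ^^ (n mod p)) c = y"
      using funpow_mod_eq[OF p(2)] by metis
    then show "y \<in> (\<lambda>i. (opn M ^^ i) c) ` {..<p}"
      using p(1) by (auto intro!: image_eqI[of _ _ "n mod p"])
  next
    fix y assume "y \<in> (\<lambda>i. (opn M ^^ i) c) ` {..<p}"
    then show "y \<in> cyclic_set M"
      using monounary_algebra_funpow[OF assms(1) c(1)] cyclic_funpow[OF c(2)]
      by (auto simp: cyclic_set_def)
  qed
  show "finite (cyclic_set M)" unfolding C by simp
  have card: "card (cyclic_set M) = p" unfolding C using card_image[OF inj] by simp
  with p show "card (cyclic_set M) \<ge> 1" by simp
  have "(opn M ^^ i) c = (opn M ^^ j) c \<longleftrightarrow> (opn M ^^ (i mod p)) c = (opn M ^^ (j mod p)) c"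
    using funpow_mod_eq[OF p(2)] by metis
  also have "\<dots> \<longleftrightarrow> i mod p = j mod p"
    using inj_on_eq_iff[OF inj, of "i mod p" "j mod p"] p(1) by simp
  finally show "(opn M ^^ i) c = (opn M ^^ j) c \<longleftrightarrow>
      i mod card (cyclic_set M) = j mod card (cyclic_set M)"
    unfolding card .
qed

text \<open>An orbit is a tail of length \<open>ht M x\<close> that, if finite, runs into the unique
  cycle. Hence height and cycle length decide which exponents give the same point.\<close>

lemma orbit_coincidence_transfer:
  assumes M: "monounary_algebra M" "connected_algebra M" "x \<in> carr M"
    and N: "monounary_algebra N" "connected_algebra N" "y \<in> carr N"
    and card: "card (cyclic_set M) = card (cyclic_set N)"
    and ht: "ht M x = ht N y"
    and eq: "(opn M ^^ i) x = (opn M ^^ j) x"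
  shows "(opn N ^^ i) y = (opn N ^^ j) y"
proof (cases "i = j")
  case False
  \<comment> \<open>Of two coinciding iterates the earlier one is already cyclic, so the height is a
    number \<open>k\<close> that is at most both exponents.\<close>
  have cyc: "cyclic M ((opn M ^^ min i j) x)"
    using False eq funpow_coincidence_cyclic[of i M x j] funpow_coincidence_cyclic[of j M x i]
    by (cases "i < j") (auto simp: min_def)
  then obtain k where k: "ht M x = enat k" "k \<le> min i j"
    using ht_le[OF cyc] by (cases "ht M x") auto
  define i' j' where "i' = i - k" and "j' = j - k"
  have ij: "i = i' + k" "j = j' + k" using k(2) by (auto simp: i'_def j'_def)
  have cM: "(opn M ^^ k) x \<in> cyclic_set M"
    using ht_enat_cyclic[OF k(1)] monounary_algebra_funpow[OF M(1,3)]
    by (simp add: cyclic_set_def)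
  have cN: "(opn N ^^ k) y \<in> cyclic_set N"
    using ht_enat_cyclic[of N y k] k(1) ht monounary_algebra_funpow[OF N(1,3)]
    by (simp add: cyclic_set_def)
  have "(opn M ^^ i') ((opn M ^^ k) x) = (opn M ^^ j') ((opn M ^^ k) x)"
    using eq unfolding ij by (simp add: funpow_add)
  then have "(opn N ^^ i') ((opn N ^^ k) y) = (opn N ^^ j') ((opn N ^^ k) y)"
    using cyclic_orbit(3)[OF M(1,2) cM] cyclic_orbit(3)[OF N(1,2) cN] card by simp
  then show ?thesis unfolding ij by (simp add: funpow_add)
qed simp

lemma orbit_isomorphism:
  assumes M: "monounary_algebra M" "connected_algebra M" "x \<in> carr M"
    and N: "monounary_algebra N" "connected_algebra N" "y \<in> carr N"
    and card: "card (cyclic_set M) = card (cyclic_set N)"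
    and ht: "ht M x = ht N y"
  obtains f where "isomorphism f (restrict_alg M (orb M x)) (restrict_alg N (orb N y))" "f x = y"
proof -
  \<comment> \<open>The choice of the exponent is immaterial by
    \<open>orbit_coincidence_transfer\<close>, which with both algebras exchanged also gives
    injectivity.\<close>
  define f where "f = (\<lambda>z. (opn N ^^ (SOME i. (opn M ^^ i) x = z)) y)"
  have f: "f ((opn M ^^ i) x) = (opn N ^^ i) y" for i
    unfolding f_def
    by (rule orbit_coincidence_transfer[OF M N card ht]) (rule someI[of _ i], simp)
  have "inj_on f (orb M x)"
  proof (rule inj_onI)
    fix u v assume "u \<in> orb M x" "v \<in> orb M x" and eq: "f u = f v"
    then obtain i j where uv: "u = (opn M ^^ i) x" "v = (opn M ^^ j) x"
      unfolding orb_def by blast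
    show "u = v"
      using orbit_coincidence_transfer[OF N M card[symmetric] ht[symmetric], of i j] eq
      unfolding uv f by blast
  qed
  moreover have "f ` orb M x = orb N y"
    unfolding orb_def image_image f by simp
  moreover have "f (opn M z) = opn N (f z)" if zin: "z \<in> orb M x" for z
  proof -
    obtain i where z: "z = (opn M ^^ i) x" using zin unfolding orb_def by blast
    show ?thesis using f[of "Suc i"] f[of i] by (simp add: z)
  qed
  ultimately have "isomorphism f (restrict_alg M (orb M x)) (restrict_alg N (orb N y))"
    unfolding isomorphism_def bij_betw_def by simp
  moreover have "f x = y" using f[of 0] by simp
  ultimately show thesis by (rule that)
qed

section \<open>Invariance of cyclicity and height under isomorphisms\<close>

lemma isomorphism_cyclic_iff:
  assumes "subalgebra M S" "isomorphism f (restrict_alg M S) N" "x \<in> S"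
  shows "cyclic N (f x) \<longleftrightarrow> cyclic M x"
proof -
  have inj: "inj_on f S" and hom: "\<And>z. z \<in> S \<Longrightarrow> f (opn M z) = opn N (f z)"
    using assms(2) unfolding isomorphism_def bij_betw_def by auto
  have cl: "\<And>z. z \<in> S \<Longrightarrow> opn M z \<in> S"
    using assms(1) unfolding subalgebra_def by blast
  have "f ((opn M ^^ n) x) = (opn N ^^ n) (f x)" for n
    using funpow_hom[of S "opn M" f "opn N", OF cl hom assms(3)] .
  then show ?thesis
    unfolding cyclic_def
    using inj_on_eq_iff[OF inj subalgebra_funpow[OF assms(1,3)] assms(3)] by metis
qed

lemma isomorphism_ht:
  assumes "subalgebra M S" "isomorphism f (restrict_alg M S) N" "x \<in> S"
  shows "ht N (f x) = ht M x"
proof -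
  have hom: "\<And>z. z \<in> S \<Longrightarrow> f (opn M z) = opn N (f z)"
    using assms(2) unfolding isomorphism_def by auto
  have cl: "\<And>z. z \<in> S \<Longrightarrow> opn M z \<in> S"
    using assms(1) unfolding subalgebra_def by blast
  have "f ((opn M ^^ n) x) = (opn N ^^ n) (f x)" for n
    using funpow_hom[of S "opn M" f "opn N", OF cl hom assms(3)] .
  then have "cyclic N ((opn N ^^ n) (f x)) \<longleftrightarrow> cyclic M ((opn M ^^ n) x)" for n
    using isomorphism_cyclic_iff[OF assms(1,2) subalgebra_funpow[OF assms(1,3)]] by metis
  then show ?thesis unfolding ht_def by simp
qed

text \<open>Both \<open>cyclic\<close> and \<open>ht\<close> refer to the operation only, which a
  restriction of the carrier leaves unchanged.\<close>

lemma cyclic_restrict: "cyclic (restrict_alg N T) = cyclic N"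
  by (simp add: cyclic_def fun_eq_iff)

lemma ht_restrict: "ht (restrict_alg N T) = ht N"
  by (simp add: ht_def fun_eq_iff cyclic_restrict)


subsection \<open>Extending isomorphisms\<close>

text \<open>The number is meant to be the distance from \<open>x\<close> to \<open>S\<close>, which
  makes the recursion primitive. \<open>h p q\<close> stands for a bijection between preimages of
  \<open>p\<close> and of \<open>q\<close>.\<close>

primrec level_ext ::
    "'a monounary \<Rightarrow> 'a set \<Rightarrow> ('a \<Rightarrow> 'b) \<Rightarrow> ('a \<Rightarrow> 'b \<Rightarrow> 'a \<Rightarrow> 'b) \<Rightarrow> nat \<Rightarrow> 'a \<Rightarrow> 'b" where
  "level_ext M S f h 0 x = f x"
| "level_ext M S f h (Suc n) x =
     (if x \<in> S then f x else h (opn M x) (level_ext M S f h n (opn M x)) x)"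

text \<open>Induction on the number of steps that lead from \<open>x\<close> into
  \<open>S\<close>.\<close>

lemma depth_induct [consumes 1, case_names closed reach base step]:
  assumes "x \<in> A"
    and "\<And>x. x \<in> A \<Longrightarrow> p x \<in> A" "\<And>x. x \<in> A \<Longrightarrow> \<exists>n. (p ^^ n) x \<in> S"
    and "\<And>x. x \<in> S \<Longrightarrow> P x" "\<And>x. x \<in> A \<Longrightarrow> x \<notin> S \<Longrightarrow> P (p x) \<Longrightarrow> P x"
  shows "P x"
proof -
  have "P x" if "(p ^^ n) x \<in> S" "x \<in> A" for n x
    using that
  proof (induction n arbitrary: x)
    case (Suc n)
    then show ?case using assms(2,4,5) by (metis comp_apply funpow_Suc_right)
  qed (use assms in auto)
  then show ?thesis using assms(1,3) by blast
qed

text \<open>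
  The extension is built along the distance to \<open>S\<close>: once \<open>p\<close> is sent to \<open>q\<close>, the preimages of \<open>p\<close>
  outside \<open>S\<close> are sent to those of \<open>q\<close> outside \<open>T\<close> by any bijection. The relation \<open>Q\<close> is the
  invariant that keeps such bijections available.
\<close>

lemma isomorphism_extension:
  assumes M: "monounary_algebra M" and S: "subalgebra M S"
    and reachM: "\<And>x. x \<in> carr M \<Longrightarrow> \<exists>n. (opn M ^^ n) x \<in> S"
    and N: "monounary_algebra N" and T: "subalgebra N T"
    and reachN: "\<And>y. y \<in> carr N \<Longrightarrow> \<exists>n. (opn N ^^ n) y \<in> T"
    and f: "isomorphism f (restrict_alg M S) (restrict_alg N T)"
    and base: "\<And>x. x \<in> S \<Longrightarrow> Q x (f x)"
    and step: "\<And>p q x y. Q p q \<Longrightarrow> x \<in> preim M p - S \<Longrightarrow> y \<in> preim N q - T \<Longrightarrow> Q x y"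
    and card: "\<And>p q. Q p q \<Longrightarrow> |preim M p - S| =o |preim N q - T|"
  obtains g where "isomorphism g M N" "\<And>x. x \<in> S \<Longrightarrow> g x = f x"
proof -
  have "\<exists>b. Q p q \<longrightarrow> bij_betw b (preim M p - S) (preim N q - T)" for p q
    using card[of p q] card_of_ordIso by blast
  then obtain h where h: "\<And>p q. Q p q \<Longrightarrow> bij_betw (h p q) (preim M p - S) (preim N q - T)"
    by metis
  define g where
    "g = (\<lambda>x. level_ext M S f h (LEAST n. (opn M ^^ n) x \<in> S) x)"
  have clM: "\<And>x. x \<in> carr M \<Longrightarrow> opn M x \<in> carr M" and clN: "\<And>x. x \<in> carr N \<Longrightarrow> opn N x \<in> carr N"
    using M N by (auto simp: monounary_algebra_def)
  have SM: "S \<subseteq> carr M" and TN: "T \<subseteq> carr N" and clS: "\<And>x. x \<in> S \<Longrightarrow> opn M x \<in> S"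
    using S T by (auto simp: subalgebra_def)
  have fbij: "bij_betw f S T" and fhom: "\<And>x. x \<in> S \<Longrightarrow> f (opn M x) = opn N (f x)"
    using f by (auto simp: isomorphism_def)
  have gS: "g x = f x" if "x \<in> S" for x
  proof -
    have "(LEAST n. (opn M ^^ n) x \<in> S) = 0" using that by (intro Least_eq_0) simp
    then show ?thesis by (simp add: g_def)
  qed
  \<comment> \<open>\<open>opn M x\<close> is one step closer to \<open>S\<close> than
    \<open>x\<close>, so unfolding \<open>level_ext\<close> once leaves exactly
    \<open>g (opn M x)\<close>.\<close>
  have gn: "g x = h (opn M x) (g (opn M x)) x" if x: "x \<in> carr M" "x \<notin> S" for x
  proof -
    obtain n where n: "(opn M ^^ n) x \<in> S" using reachM x by blast
    have "(LEAST n. (opn M ^^ n) x \<in> S) = Suc (LEAST n. (opn M ^^ Suc n) x \<in> S)"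
      by (rule Least_Suc[where n = n]) (use n x in auto)
    then have "(LEAST n. (opn M ^^ n) x \<in> S) = Suc (LEAST n. (opn M ^^ n) (opn M x) \<in> S)"
      by (simp add: funpow_swap1)
    then show ?thesis using x by (simp add: g_def)
  qed
  have key: "g x \<in> preim N (g (opn M x)) - T" if "Q (opn M x) (g (opn M x))" "x \<in> carr M" "x \<notin> S" for x
    using bij_betw_apply[OF h[OF that(1)], of x] that gn by (simp add: preim_def)
  have Q: "Q x (g x)" if "x \<in> carr M" for x
    using that
  proof (induction x rule: depth_induct[where p = "opn M" and S = S])
    case (step x)
    have "x \<in> preim M (opn M x) - S" using step by (simp add: preim_def)
    \<comment> \<open>\<open>assms(9)\<close> is the hypothesis \<open>step\<close>, whose name is
      hidden by the induction case.\<close>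
    then show ?case using key assms(9) step by blast
  qed (use clM reachM base gS in auto)
  have out: "g x \<in> carr N" "opn N (g x) = g (opn M x)" "g x \<notin> T" if "x \<in> carr M" "x \<notin> S" for x
    using key[OF Q that] that clM by (auto simp: preim_def)
  have inT: "g x \<in> T" if "x \<in> S" for x
    using bij_betw_apply[OF fbij that] gS that by simp
  have hom: "g (opn M x) = opn N (g x)" if "x \<in> carr M" for x
    using that out gS clS fhom by (cases "x \<in> S") auto
  \<comment> \<open>Since \<open>g\<close> maps \<open>S\<close> into \<open>T\<close> and
    everything else outside \<open>T\<close>, equal values come from the same side. Outside
    \<open>S\<close> the images under \<open>opn M\<close> agree by induction, and then one
    bijection \<open>h\<close> separates \<open>x\<close> from \<open>y\<close>.\<close>
  have inj: "x = y" if "x \<in> carr M" "y \<in> carr M" "g x = g y" for x y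
    using that
  proof (induction x arbitrary: y rule: depth_induct[where p = "opn M" and S = S])
    case (base x)
    then have "y \<in> S" using inT out by metis
    then show ?case
      using base gS bij_betw_imp_inj_on[OF fbij] by (metis inj_onD)
  next
    case (step x)
    have y: "y \<notin> S" using inT out step by metis
    have "g (opn M x) = g (opn M y)" using hom step by metis
    then have xy: "opn M x = opn M y" using step clM by blast
    have "h (opn M x) (g (opn M x)) x = h (opn M x) (g (opn M x)) y"
      using gn[of x] gn[of y] step y xy by simp
    moreover have "inj_on (h (opn M x) (g (opn M x))) (preim M (opn M x) - S)"
      using h Q clM step bij_betw_imp_inj_on by blast
    ultimately show ?case
      using step y xy by (auto simp: preim_def dest: inj_onD)
  qed (use clM reachM in auto)
  \<comment> \<open>By induction \<open>opn N y\<close> is some \<open>g p\<close>, and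
    \<open>h p (g p)\<close> reaches every preimage of \<open>g p\<close> outside \<open>T\<close>,
    among them \<open>y\<close>.\<close>
  have surj: "y \<in> g ` carr M" if "y \<in> carr N" for y
    using that
  proof (induction y rule: depth_induct[where p = "opn N" and S = T])
    case (base y)
    then obtain x where "x \<in> S" "y = f x"
      using bij_betw_imp_surj_on[OF fbij] by blast
    then show ?case using gS SM by (metis image_eqI subsetD)
  next
    case (step y)
    then obtain p where p: "p \<in> carr M" "opn N y = g p" by blast
    then have "y \<in> preim N (g p) - T" using step by (simp add: preim_def)
    then obtain x where x: "x \<in> preim M p - S" "y = h p (g p) x"
      using bij_betw_imp_surj_on[OF h[OF Q[OF p(1)]]] by blast
    then have "y = g x" "x \<in> carr M" using gn[of x] by (simp_all add: preim_def)
    then show ?case by (rule image_eqI)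
  qed (use clN reachN in auto)
  have "g x \<in> carr N" if "x \<in> carr M" for x
    using out inT TN that by (cases "x \<in> S") auto
  then have "isomorphism g M N"
    unfolding isomorphism_def bij_betw_def inj_on_def using inj surj hom by blast
  then show thesis using gS by (rule that)
qed

section \<open>Removing finite sets of preimages\<close>

lemma card_of_infinite_Diff:
  assumes "infinite A" "finite F"
  shows "|A - F| =o |A|"
  using assms(2)
proof (induction F)
  case (insert a F)
  have "infinite (A - F)" using assms(1) insert by simp
  then obtain b where "bij_betw b (A - F) (A - F - {a})"
    using infinite_imp_bij_betw[of "A - F" a] by auto
  then have "|A - F| =o |A - insert a F|"
    unfolding Diff_insert[of A a F] by (rule card_of_ordIsoI)
  then show ?case
    using insert.IH ordIso_symmetric ordIso_transitive by blast
qed (simp add: card_of_refl)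

text \<open>Finite sets are counted, and infinite ones keep their cardinality. Finiteness of the
  removed sets is essential, as infinite cardinals do not admit subtraction.\<close>

lemma card_of_Diff_finite:
  assumes "|A| =o |B|" "finite A'" "bij_betw b A' B'" "A' \<subseteq> A" "B' \<subseteq> B"
  shows "|A - A'| =o |B - B'|"
proof (cases "finite A")
  case True
  then have B: "finite B" using assms(1) card_of_ordIso_finite by blast
  have "card A = card B"
    using assms(1) card_of_ordIso bij_betw_same_card by blast
  moreover have "card A' = card B'" "finite B'"
    using assms(3) bij_betw_same_card assms(5) B finite_subset by blast+
  ultimately have "card (A - A') = card (B - B')"
    using assms(2,4,5) by (simp add: card_Diff_subset)
  then obtain c where "bij_betw c (A - A') (B - B')"
    using True B finite_same_card_bij by blast
  then show ?thesis by (rule card_of_ordIsoI)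
next
  case False
  then have B: "infinite B" using assms(1) card_of_ordIso_finite by blast
  have "finite B'" using assms(2,3) bij_betw_finite by blast
  then have "|B - B'| =o |B|" by (rule card_of_infinite_Diff[OF B])
  then have "|A| =o |B - B'|" by (rule ordIso_transitive[OF assms(1) ordIso_symmetric])
  then show ?thesis
    by (rule ordIso_transitive[OF card_of_infinite_Diff[OF False assms(2)]])
qed

text \<open>An orbit that repeats is finite, and one that never repeats contains at most one
  preimage of \<open>x\<close>.\<close>

lemma finitely_generated_preim_finite:
  assumes "monounary_algebra M" "finitely_generated M S"
  shows "finite (preim M x \<inter> S)"
proof -
  obtain F where F: "finite F" "S = (\<Union>y\<in>F. orb M y)"
    using assms subalgebra_hull_eq unfolding finitely_generated_def by metis
  have "finite (preim M x \<inter> orb M y)" for y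
  proof (cases "\<exists>i j. i < j \<and> (opn M ^^ i) y = (opn M ^^ j) y")
    case True
    then obtain i j where ij: "i < j" "(opn M ^^ i) y = (opn M ^^ j) y" by blast
    \<comment> \<open>From exponent \<open>j\<close> on, lowering the exponent by
      \<open>j - i\<close> does not change the point.\<close>
    have "(opn M ^^ n) y \<in> (\<lambda>m. (opn M ^^ m) y) ` {..<j}" for n
    proof (induction n rule: less_induct)
      case (less n)
      show ?case
      proof (cases "n < j")
        case False
        then have "(opn M ^^ n) y = (opn M ^^ (n - j + i)) y"
          using ij(2) by (metis comp_apply funpow_add le_add_diff_inverse2 not_less)
        then show ?thesis using less[of "n - j + i"] False ij(1) by simp
      qed simp
    qed
    then have "orb M y \<subseteq> (\<lambda>m. (opn M ^^ m) y) ` {..<j}" unfolding orb_def by blast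
    then show ?thesis by (meson finite_Int finite_imageI finite_lessThan finite_subset)
  next
    case False
    have "u = v" if uv: "u \<in> preim M x \<inter> orb M y" "v \<in> preim M x \<inter> orb M y" for u v
    proof -
      obtain i j where ij: "u = (opn M ^^ i) y" "v = (opn M ^^ j) y"
        using uv unfolding orb_def by blast
      then have "(opn M ^^ Suc i) y = (opn M ^^ Suc j) y" using uv by (simp add: preim_def)
      then have "i = j" using False by (metis nat.inject nat_neq_iff)
      then show ?thesis using ij by simp
    qed
    then have "\<exists>u. preim M x \<inter> orb M y \<subseteq> {u}" by blast
    then show ?thesis by (auto dest: finite_subset)
  qed
  then have "finite (\<Union>y\<in>F. preim M x \<inter> orb M y)" using F(1) by blast
  then show ?thesis unfolding F(2) Int_UN_distrib .
qed


subsection \<open>Level-regular algebras\<close>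

text \<open>Only cyclic elements have cyclic preimages, so removing these treats all heights alike.
  Comparing two algebras lets one notion serve both for automorphisms (\<open>M = N\<close>) and for
  uniqueness up to isomorphism.\<close>

definition level_regular :: "'a monounary \<Rightarrow> 'b monounary \<Rightarrow> bool" where
  "level_regular M N \<longleftrightarrow>
     (\<forall>x\<in>carr M. \<forall>y\<in>carr N. ht M x = ht N y \<longrightarrow>
        |preim M x - cyclic_set M| =o |preim N y - cyclic_set N| )"

lemma level_regular_extension:
  assumes M: "monounary_algebra M" "connected_algebra M"
    and N: "monounary_algebra N" "connected_algebra N"
    and reg: "level_regular M N"
    and S: "subalgebra M S" "finitely_generated M S"
    and T: "subalgebra N T"
    and f: "isomorphism f (restrict_alg M S) (restrict_alg N T)"
  obtains g where "isomorphism g M N" "\<And>x. x \<in> S \<Longrightarrow> g x = f x"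
proof -
  have SM: "S \<subseteq> carr M" and TN: "T \<subseteq> carr N" and clS: "\<And>x. x \<in> S \<Longrightarrow> opn M x \<in> S"
    and clT: "\<And>x. x \<in> T \<Longrightarrow> opn N x \<in> T"
    using S T by (auto simp: subalgebra_def)
  have fbij: "bij_betw f S T" and fhom: "\<And>x. x \<in> S \<Longrightarrow> f (opn M x) = opn N (f x)"
    using f by (auto simp: isomorphism_def)
  have CS: "cyclic_set M \<subseteq> S" and CT: "cyclic_set N \<subseteq> T"
    using cyclic_set_subset_subalgebra M N S T by blast+
  have fT: "f x \<in> T" if "x \<in> S" for x using bij_betw_apply[OF fbij that] .
  have fht: "ht N (f x) = ht M x" and fcyc: "f x \<in> cyclic_set N \<longleftrightarrow> x \<in> cyclic_set M"
    if "x \<in> S" for x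
    using isomorphism_ht[OF S(1) f that] isomorphism_cyclic_iff[OF S(1) f that] fT[OF that]
      SM TN that
    by (auto simp: ht_restrict cyclic_restrict cyclic_set_def)
  \<comment> \<open>On \<open>S\<close> the invariant is the graph of \<open>f\<close>, because
    counting the preimages outside \<open>S\<close> and \<open>T\<close> uses
    \<open>q = f p\<close>; elsewhere equal heights suffice.\<close>
  define Q where "Q = (\<lambda>p q. p \<in> S \<and> q = f p \<or>
    p \<in> carr M - S \<and> q \<in> carr N - T \<and> ht M p = ht N q)"
  have Qht: "p \<in> carr M" "q \<in> carr N" "ht M p = ht N q" if "Q p q" for p q
    using that fht fT SM TN unfolding Q_def by auto
  show thesis
  proof (rule isomorphism_extension[OF M(1) S(1) _ N(1) T _ f, of Q])
    show "\<exists>n. (opn M ^^ n) x \<in> S" if "x \<in> carr M" for x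
      using connected_reaches_subalgebra[OF M(2) S(1) that] .
    show "\<exists>n. (opn N ^^ n) y \<in> T" if "y \<in> carr N" for y
      using connected_reaches_subalgebra[OF N(2) T that] .
    show "Q x (f x)" if "x \<in> S" for x using that by (simp add: Q_def)
  next
    fix p q x y
    assume Q: "Q p q" and x: "x \<in> preim M p - S" and y: "y \<in> preim N q - T"
    \<comment> \<open>All cyclic elements lie in \<open>S\<close> and \<open>T\<close>, so the
      heights of \<open>x\<close> and \<open>y\<close> are the successors of those of
      \<open>p\<close> and \<open>q\<close>.\<close>
    have "\<not> cyclic M x" "\<not> cyclic N y"
      using x y CS CT by (auto simp: preim_def cyclic_set_def)
    then have "ht M x = ht N y"
      using ht_noncyclic[of M x] ht_noncyclic[of N y] x y Qht(3)[OF Q] by (simp add: preim_def)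
    then show "Q x y" using x y by (auto simp: Q_def preim_def)
  next
    fix p q assume Q: "Q p q"
    have eq: "|preim M p - cyclic_set M| =o |preim N q - cyclic_set N|"
      using reg Qht[OF Q] unfolding level_regular_def by blast
    show "|preim M p - S| =o |preim N q - T|"
    proof (cases "p \<in> S")
      case True
      then have q: "q = f p" using Q by (simp add: Q_def)
      \<comment> \<open>The noncyclic preimages inside \<open>S\<close> and \<open>T\<close> are
        finitely many and correspond under \<open>f\<close>; removing them from equally large sets
        leaves the preimages outside \<open>S\<close> and \<open>T\<close>.\<close>
      let ?A = "preim M p \<inter> S - cyclic_set M" and ?B = "preim N q \<inter> T - cyclic_set N"
      have "f ` ?A = ?B"
      proof (intro equalityI subsetI)
        fix v assume "v \<in> f ` ?A"
        then show "v \<in> ?B" using fcyc fT fhom TN q by (auto simp: preim_def)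
      next
        fix v assume v: "v \<in> ?B"
        then obtain u where u: "u \<in> S" "v = f u"
          using bij_betw_imp_surj_on[OF fbij] by blast
        have "f (opn M u) = f p" using v u q fhom by (simp add: preim_def)
        then have "opn M u = p"
          using bij_betw_imp_inj_on[OF fbij] clS u(1) True by (meson inj_onD)
        then show "v \<in> f ` ?A" using u v fcyc SM by (auto simp: preim_def)
      qed
      then have b: "bij_betw f ?A ?B"
        using bij_betw_imp_inj_on[OF fbij] by (auto simp: bij_betw_def intro: inj_on_subset)
      have fin: "finite ?A"
        using finitely_generated_preim_finite[OF M(1) S(2)] by simp
      have "|preim M p - cyclic_set M - ?A| =o |preim N q - cyclic_set N - ?B|"
        by (rule card_of_Diff_finite[OF eq fin b]) auto
      moreover have "preim M p - cyclic_set M - ?A = preim M p - S"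
        "preim N q - cyclic_set N - ?B = preim N q - T" using CS CT by auto
      ultimately show ?thesis by simp
    next
      case False
      then have "q \<notin> T" using Q by (simp add: Q_def)
      then have "preim M p \<inter> S = {}" "preim N q \<inter> T = {}"
        using False clS clT by (auto simp: preim_def)
      then have "preim M p - cyclic_set M = preim M p - S" "preim N q - cyclic_set N = preim N q - T"
        using CS CT by auto
      then show ?thesis using eq by simp
    qed
  qed (rule that)
qed

lemma monounary_algebra_subalgebra: "monounary_algebra M \<Longrightarrow> subalgebra M (carr M)"
  by (simp add: monounary_algebra_def subalgebra_def)

lemma isomorphism_levels:
  assumes M: "monounary_algebra M" and g: "isomorphism g M N" and x: "x \<in> carr M"
  shows "g x \<in> carr N" "ht N (g x) = ht M x"
    "|preim M x - cyclic_set M| =o |preim N (g x) - cyclic_set N|"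
proof -
  have sub: "subalgebra M (carr M)" and g': "isomorphism g (restrict_alg M (carr M)) N"
    using M g by (simp_all add: monounary_algebra_subalgebra)
  have bij: "bij_betw g (carr M) (carr N)" and hom: "\<And>x. x \<in> carr M \<Longrightarrow> g (opn M x) = opn N (g x)"
    using g by (auto simp: isomorphism_def)
  have inN: "\<And>x. x \<in> carr M \<Longrightarrow> g x \<in> carr N" using bij_betw_apply[OF bij] .
  show "g x \<in> carr N" "ht N (g x) = ht M x"
    using inN x isomorphism_ht[OF sub g' x] by auto
  have cyc: "cyclic N (g u) \<longleftrightarrow> cyclic M u" if "u \<in> carr M" for u
    using isomorphism_cyclic_iff[OF sub g' that] .
  have cl: "\<And>x. x \<in> carr M \<Longrightarrow> opn M x \<in> carr M" using M by (simp add: monounary_algebra_def)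
  have "g ` (preim M x - cyclic_set M) = preim N (g x) - cyclic_set N"
  proof (intro equalityI subsetI)
    fix v assume "v \<in> g ` (preim M x - cyclic_set M)"
    then show "v \<in> preim N (g x) - cyclic_set N"
      using cyc inN hom by (auto simp: preim_def cyclic_set_def)
  next
    fix v assume v: "v \<in> preim N (g x) - cyclic_set N"
    then obtain u where u: "u \<in> carr M" "v = g u"
      using bij_betw_imp_surj_on[OF bij] by (auto simp: preim_def)
    have "g (opn M u) = g x" using v u hom by (simp add: preim_def)
    then have "opn M u = x"
      using bij_betw_imp_inj_on[OF bij] cl u(1) x by (meson inj_onD)
    then show "v \<in> g ` (preim M x - cyclic_set M)"
      using u v cyc inN by (auto simp: preim_def cyclic_set_def)
  qed
  then have "bij_betw g (preim M x - cyclic_set M) (preim N (g x) - cyclic_set N)"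
    using bij_betw_imp_inj_on[OF bij] by (auto simp: bij_betw_def preim_def intro: inj_on_subset)
  then show "|preim M x - cyclic_set M| =o |preim N (g x) - cyclic_set N|"
    by (rule card_of_ordIsoI)
qed

lemma ultrahomogeneous_iff_level_regular:
  assumes M: "monounary_algebra M" "connected_algebra M"
  shows "ultrahomogeneous M \<longleftrightarrow> level_regular M M"
proof
  assume uh: "ultrahomogeneous M"
  show "level_regular M M"
    unfolding level_regular_def
  proof (intro ballI impI)
    fix x y assume xy: "x \<in> carr M" "y \<in> carr M" "ht M x = ht M y"
    \<comment> \<open>Equal heights give isomorphic orbits, so ultrahomogeneity yields an
      automorphism taking \<open>x\<close> to \<open>y\<close>, which carries preimages to
      preimages.\<close>
    obtain f where f: "isomorphism f (restrict_alg M (orb M x)) (restrict_alg M (orb M y))" "f x = y"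
      using orbit_isomorphism[OF M xy(1) M xy(2) refl xy(3)] .
    moreover have "subalgebra M (orb M u) \<and> finitely_generated M (orb M u)" if "u \<in> carr M" for u
      using orb_finitely_generated[OF M(1) that] by blast
    ultimately obtain g where g: "isomorphism g M M" "\<forall>z\<in>orb M x. g z = f z"
      using uh[unfolded ultrahomogeneous_def, rule_format, of "orb M x" "orb M y" f] xy(1,2)
      by blast
    have "g x = y" using f g orb_self by metis
    then show "|preim M x - cyclic_set M| =o |preim M y - cyclic_set M|"
      using isomorphism_levels(3)[OF M(1) g(1) xy(1)] by simp
  qed
next
  assume reg: "level_regular M M"
  show "ultrahomogeneous M"
    unfolding ultrahomogeneous_def
  proof (intro allI impI, elim conjE)
    fix S T f
    assume "subalgebra M S" "finitely_generated M S" "subalgebra M T"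
      "isomorphism f (restrict_alg M S) (restrict_alg M T)"
    then show "\<exists>g. isomorphism g M M \<and> (\<forall>x\<in>S. g x = f x)"
      using level_regular_extension[OF M M reg] by metis
  qed
qed

lemma level_regular_transfer:
  assumes "monounary_algebra M" "isomorphic M N" "level_regular N N"
  shows "level_regular M M"
proof -
  obtain g where g: "isomorphism g M N" using assms(2) unfolding isomorphic_def by blast
  note iso = isomorphism_levels[OF assms(1) g]
  show ?thesis
    unfolding level_regular_def
  proof (intro ballI impI)
    fix x y assume xy: "x \<in> carr M" "y \<in> carr M" "ht M x = ht M y"
    then have "|preim N (g x) - cyclic_set N| =o |preim N (g y) - cyclic_set N|"
      using assms(3) iso(1,2) unfolding level_regular_def by metis
    then show "|preim M x - cyclic_set M| =o |preim M y - cyclic_set M|"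
      using ordIso_transitive[OF ordIso_transitive[OF iso(3)[OF xy(1)]]
          ordIso_symmetric[OF iso(3)[OF xy(2)]]] by blast
  qed
qed

text \<open>The extension starts from an isomorphism of two orbits, which are finitely generated.
  Cyclic sets are finite by \<open>cyclic_orbit\<close>, so \<open>card\<close> is faithful and 0
  means that there is no cycle.\<close>

lemma level_regular_isomorphic:
  assumes M: "monounary_algebra M" "connected_algebra M" "x \<in> carr M"
    and N: "monounary_algebra N" "connected_algebra N" "y \<in> carr N"
    and card: "card (cyclic_set M) = card (cyclic_set N)" and ht: "ht M x = ht N y"
    and reg: "level_regular M N"
  shows "isomorphic M N"
proof -
  obtain f where "isomorphism f (restrict_alg M (orb M x)) (restrict_alg N (orb N y))" "f x = y"
    using orbit_isomorphism[OF M N card ht] .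
  then show ?thesis
    using level_regular_extension[OF M(1,2) N(1,2) reg] orb_finitely_generated M N
    unfolding isomorphic_def by metis
qed


subsection \<open>The algebras \<open>\<B>\<^sub>\<alpha>\<close> and \<open>\<A>[n; \<alpha>\<^sub>0, \<alpha>\<^sub>1, \<dots>]\<close>\<close>

lemma acyclic_ht:
  assumes "monounary_algebra M" "cyclic_set M = {}" "x \<in> carr M"
  shows "ht M x = \<infinity>"
  using assms monounary_algebra_funpow[OF assms(1,3)]
  unfolding ht_def cyclic_set_def by auto

lemma is_B_alg_level_regular:
  assumes "is_B_alg \<alpha> M" "is_B_alg \<alpha> N"
  shows "level_regular M N"
  unfolding level_regular_def
proof (intro ballI impI)
  fix x y assume "x \<in> carr M" "y \<in> carr N"
  then have "|preim M x - cyclic_set M| =o \<alpha>" "|preim N y - cyclic_set N| =o \<alpha>"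
    using assms unfolding is_B_alg_def by auto
  then show "|preim M x - cyclic_set M| =o |preim N y - cyclic_set N|"
    by (rule ordIso_transitive[OF _ ordIso_symmetric])
qed

text \<open>Every height is \<infinity> and both cyclic sets are empty, so the orbits of any two
  elements may serve as a start.\<close>

lemma is_B_alg_isomorphic:
  assumes "is_B_alg \<alpha> M" "is_B_alg \<alpha> N"
  shows "isomorphic M N"
proof -
  obtain x y where "x \<in> carr M" "y \<in> carr N"
    using assms unfolding is_B_alg_def monounary_algebra_def by blast
  then show ?thesis
    using level_regular_isomorphic[of M x N y] is_B_alg_level_regular[OF assms] assms
      acyclic_ht[of M x] acyclic_ht[of N y]
    unfolding is_B_alg_def by simp
qed

lemma connected_ht_finite:
  assumes "connected_algebra M" "cyclic_set M \<noteq> {}" "x \<in> carr M"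
  obtains k where "ht M x = enat k"
proof -
  obtain c where "c \<in> carr M" "cyclic M c" using assms(2) unfolding cyclic_set_def by blast
  then obtain n where "cyclic M ((opn M ^^ n) x)"
    using cyclic_reachable[OF assms(1,3)] by metis
  then show thesis using ht_le[of M n x] that by (cases "ht M x") auto
qed

lemma preim_noncyclic:
  assumes "ht M x = enat k" "k > 0"
  shows "preim M x - cyclic_set M = preim M x"
proof -
  have "\<not> cyclic M x" using assms by (simp add: cyclic_iff_ht zero_enat_def)
  then show ?thesis by (auto dest: cyclic_opn simp: preim_def cyclic_set_def)
qed

text \<open>Joins the two clauses of \<open>is_A_alg\<close>: for \<open>k > 0\<close> there are no
  cyclic preimages to remove.\<close>

lemma is_A_alg_levels:
  assumes "is_A_alg n \<alpha> M" "x \<in> carr M" "ht M x = enat k"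
  shows "|preim M x - cyclic_set M| =o \<alpha> k"
proof (cases "k = 0")
  case True
  then have "x \<in> cyclic_set M"
    using assms by (simp add: cyclic_iff_ht zero_enat_def cyclic_set_def)
  then show ?thesis using assms True unfolding is_A_alg_def by blast
next
  case False
  then show ?thesis
    using assms preim_noncyclic[OF assms(3)] unfolding is_A_alg_def by simp
qed

lemma is_A_alg_level_regular:
  assumes "n \<ge> 1" "is_A_alg n \<alpha> M" "is_A_alg n \<alpha> N"
  shows "level_regular M N"
  unfolding level_regular_def
proof (intro ballI impI)
  fix x y assume xy: "x \<in> carr M" "y \<in> carr N" "ht M x = ht N y"
  have "connected_algebra M" "cyclic_set M \<noteq> {}"
    using assms unfolding is_A_alg_def by auto
  then obtain k where "ht M x = enat k" by (rule connected_ht_finite[OF _ _ xy(1)])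
  then have "|preim M x - cyclic_set M| =o \<alpha> k" "|preim N y - cyclic_set N| =o \<alpha> k"
    using is_A_alg_levels[OF assms(2) xy(1)] is_A_alg_levels[OF assms(3) xy(2)] xy(3) by auto
  then show "|preim M x - cyclic_set M| =o |preim N y - cyclic_set N|"
    by (rule ordIso_transitive[OF _ ordIso_symmetric])
qed

lemma is_A_alg_isomorphic:
  assumes "n \<ge> 1" "is_A_alg n \<alpha> M" "is_A_alg n \<alpha> N"
  shows "isomorphic M N"
proof -
  have "cyclic_set M \<noteq> {}" "cyclic_set N \<noteq> {}"
    using assms unfolding is_A_alg_def by auto
  then obtain x y where "x \<in> carr M" "y \<in> carr N" "ht M x = 0" "ht N y = 0"
    unfolding cyclic_set_def cyclic_iff_ht by blast
  then show ?thesis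
    using level_regular_isomorphic[of M x N y] is_A_alg_level_regular[OF assms] assms
    unfolding is_A_alg_def by simp
qed

lemma Cnotzero_card_of: "A \<noteq> {} \<Longrightarrow> Cnotzero |A|"
  by (simp add: card_of_ordIso_czero_iff_empty card_of_Card_order)

lemma level_regular_is_B_alg:
  fixes M :: "'a monounary"
  assumes M: "monounary_algebra M" "connected_algebra M"
    and reg: "level_regular M M" and C: "cyclic_set M = {}"
  obtains \<alpha> :: "'a rel" where "Cnotzero \<alpha>" "is_B_alg \<alpha> M"
proof -
  obtain x where x: "x \<in> carr M" using M(1) unfolding monounary_algebra_def by blast
  \<comment> \<open>The reference point is \<open>opn M x\<close> because it certainly has a
    preimage, which makes its cardinal nonzero.\<close>
  have y: "opn M x \<in> carr M" using M(1) x unfolding monounary_algebra_def by blast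
  have eq: "|preim M u| =o |preim M (opn M x)|" if "u \<in> carr M" for u
    using reg that y acyclic_ht[OF M(1) C] C unfolding level_regular_def by fastforce
  have "x \<in> preim M (opn M x)" using x by (simp add: preim_def)
  then have "Cnotzero |preim M (opn M x)|"
    by (intro Cnotzero_card_of) blast
  moreover have "is_B_alg |preim M (opn M x)| M"
    using M C eq by (simp add: is_B_alg_def)
  ultimately show thesis by (rule that)
qed

lemma level_regular_is_A_alg:
  fixes M :: "'a monounary"
  assumes M: "monounary_algebra M" "connected_algebra M"
    and reg: "level_regular M M" and C: "cyclic_set M \<noteq> {}"
  obtains \<alpha> :: "nat \<Rightarrow> 'a rel" where "cardinal_list \<alpha>" "is_A_alg (card (cyclic_set M)) \<alpha> M"
    "card (cyclic_set M) \<ge> 1"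
proof -
  \<comment> \<open>By regularity any element of height \<open>k\<close> represents its level.
    Heights that do not occur get the empty set, so that \<open>\<alpha> k\<close> is zero
    there.\<close>
  define D where "D = (\<lambda>k. if \<exists>x\<in>carr M. ht M x = enat k
    then preim M (SOME x. x \<in> carr M \<and> ht M x = enat k) - cyclic_set M else {})"
  define \<alpha> where "\<alpha> = (\<lambda>k. |D k| )"
  have lev: "|preim M x - cyclic_set M| =o \<alpha> k" if "x \<in> carr M" "ht M x = enat k" for x k
  proof -
    define z where "z = (SOME x. x \<in> carr M \<and> ht M x = enat k)"
    have z: "z \<in> carr M" "ht M z = enat k"
      using someI[of "\<lambda>x. x \<in> carr M \<and> ht M x = enat k" x] that unfolding z_def by auto
    have "D k = preim M z - cyclic_set M" using that unfolding D_def z_def by auto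
    then show ?thesis using reg that z unfolding level_regular_def \<alpha>_def by simp
  qed
  obtain c where c: "c \<in> cyclic_set M" using C by blast
  \<comment> \<open>An element of height \<open>k + 1\<close> is a noncyclic preimage of an element
    of height \<open>k\<close>. Hence only zeros follow a zero, as for a list padded with
    zeros.\<close>
  have down: "D k \<noteq> {}" if nonempty: "D (Suc k) \<noteq> {}" for k
  proof -
    obtain x where x: "x \<in> carr M" "ht M x = enat (Suc k)"
      using nonempty unfolding D_def by (auto split: if_splits)
    have nc: "\<not> cyclic M x" using x by (simp add: cyclic_iff_ht zero_enat_def)
    then have "ht M (opn M x) = enat k"
      using ht_noncyclic[of M x] x(2) by (simp add: eSuc_enat[symmetric])
    moreover have "opn M x \<in> carr M" using M(1) x unfolding monounary_algebra_def by blast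
    ultimately have "|preim M (opn M x) - cyclic_set M| =o \<alpha> k" using lev by blast
    moreover have "x \<in> preim M (opn M x) - cyclic_set M"
      using x nc by (simp add: preim_def cyclic_set_def)
    ultimately show ?thesis
      unfolding \<alpha>_def using card_of_empty2 by fastforce
  qed
  define h where "h = (if \<exists>k. D k = {} then enat (LEAST k. D k = {}) else \<infinity>)"
  have stay: "D (m + j) = {}" if "D m = {}" for m j
    using that down by (induction j) auto
  have "enat k < h \<longleftrightarrow> D k \<noteq> {}" for k
  proof (cases "\<exists>k. D k = {}")
    case True
    define l where "l = (LEAST k. D k = {})"
    have "D l = {}" using LeastI_ex[OF True] by (simp add: l_def)
    then have "D k = {}" if "l \<le> k" for k
      using stay[of l "k - l"] that by simp
    moreover have "D k \<noteq> {}" if "k < l" for k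
      using not_less_Least[of k "\<lambda>k. D k = {}"] that by (simp add: l_def)
    moreover have "h = enat l" using True by (simp add: h_def l_def)
    ultimately show ?thesis by (metis enat_ord_simps(2) not_le)
  qed (simp add: h_def)
  moreover have "Cnotzero (\<alpha> k)" if "D k \<noteq> {}" for k
    unfolding \<alpha>_def by (rule Cnotzero_card_of[OF that])
  \<comment> \<open>\<open>cardinal_list\<close> asks for equality with \<open>czero\<close>, not
    just for \<open>=o\<close>; it holds because \<open>czero\<close> is the cardinal of the empty
    set.\<close>
  moreover have "\<alpha> k = czero" if "D k = {}" for k
    using that by (simp add: \<alpha>_def czero_def)
  ultimately have "cardinal_list \<alpha>" unfolding cardinal_list_def by metis
  moreover have "is_A_alg (card (cyclic_set M)) \<alpha> M"
    unfolding is_A_alg_def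
  proof (intro conjI ballI allI impI)
    show "finite (cyclic_set M)" using cyclic_orbit(1)[OF M c] .
    show "|preim M x - cyclic_set M| =o \<alpha> 0" if "x \<in> cyclic_set M" for x
      using that lev by (auto simp: cyclic_set_def cyclic_iff_ht zero_enat_def)
    show "|preim M x| =o \<alpha> k" if "x \<in> carr M" "0 < k" "ht M x = enat k" for x k
      using lev[OF that(1,3)] preim_noncyclic[OF that(3,2)] by simp
  qed (use M in simp_all)
  ultimately show thesis using that cyclic_orbit(2)[OF M c] by blast
qed

text \<open>Preimage sets consist of elements of \<open>'a\<close>, so cardinal orders on
  \<open>'a\<close> provide all cardinals that can occur.\<close>

theorem theorem4p9:
  fixes M :: "'a monounary"
  assumes "monounary_algebra M" and "connected_algebra M"
  shows "ultrahomogeneous M \<longleftrightarrow>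
    (\<exists>\<alpha> :: 'a rel. Cnotzero \<alpha> \<and> isomorphic M (B_alg \<alpha>)) \<or>
    (\<exists>(n::nat) (\<alpha> :: nat \<Rightarrow> 'a rel). n \<ge> 1 \<and> cardinal_list \<alpha> \<and> isomorphic M (A_alg n \<alpha>))"
  unfolding ultrahomogeneous_iff_level_regular[OF assms]
proof
  assume reg: "level_regular M M"
  show "(\<exists>\<alpha> :: 'a rel. Cnotzero \<alpha> \<and> isomorphic M (B_alg \<alpha>)) \<or>
    (\<exists>(n::nat) (\<alpha> :: nat \<Rightarrow> 'a rel). n \<ge> 1 \<and> cardinal_list \<alpha> \<and> isomorphic M (A_alg n \<alpha>))"
  proof (cases "cyclic_set M = {}")
    case True
    then show ?thesis
      using level_regular_is_B_alg[OF assms reg] is_B_alg_isomorphic is_B_alg_B_alg by metis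
  next
    case False
    then show ?thesis
      using level_regular_is_A_alg[OF assms reg] is_A_alg_isomorphic is_A_alg_A_alg by metis
  qed
next
  assume "(\<exists>\<alpha> :: 'a rel. Cnotzero \<alpha> \<and> isomorphic M (B_alg \<alpha>)) \<or>
    (\<exists>(n::nat) (\<alpha> :: nat \<Rightarrow> 'a rel). n \<ge> 1 \<and> cardinal_list \<alpha> \<and> isomorphic M (A_alg n \<alpha>))"
  then show "level_regular M M"
    using level_regular_transfer[OF assms(1)] is_B_alg_level_regular is_B_alg_B_alg
      is_A_alg_level_regular is_A_alg_A_alg by metis
qed

end
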